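(* Let $K$ be a field, let $P=K[a_0,a_1,\dots,a_n]$, let $S=K[g_1,\dots,g_r]\subseteq P$, and let $g\in S\setminus\{0\}$. For any choices of generators made in the construction of the sequence $E_g^i(S)$, the following conditions are equivalent. (a) The algebra $S:g^\infty$ is finitely generated. (b) There exists $i$ such that $E_g^i(S)=E_g^{i+1}(S)$. Moreover, if the two equivalent conditions are satisfied, then $S:g^\infty=E_g^i(S)$ (for $i$ as in (b)).
   Context: For a subalgebra $B$ of $P$: $B:g^\infty=\bigcup_{i\in\mathbb N}\{f\in P\mid g^if\in B\}$; it is a $K$-subalgebra of $P$ when $g\in B$. The ideal of relations $\mathrm{Rel}_g(f_1,\dots,f_s)$ of $f_1,\dots,f_s\in P$ modulo $g$ is the kernel of the composition $K[x_1,\dots,x_s]\to P\to P/\langle g\rangle$, where the first map is the $K$-algebra homomorphism with $x_i\mapsto f_i$ and the second is the canonical projection. For $f\in P$, $f:g^\infty$ is the polynomial $f/g^i$, where $g^i$ is the highest power of $g$ dividing $f$; by convention $f:g^\infty=f$ if $f=0$ or $g$ is a constant. For a finitely generated subalgebra $B=K[f_1,\dots,f_s]$ of $P$ with $g\in B\setminus\{0\}$, and a finite set of generators $\{H_1,\dots,H_t\}$ of $\mathrm{Rel}_g(f_1,\dots,f_s)$, let $E_g(B)=K[f_1,\dots,f_s,h_1,\dots,h_t]$ where $h_i=H_i(f_1,\dots,f_s):g^\infty$. By abuse of notation $E_g(B)$ is written as depending only on $B$, although it depends on the chosen generators $f_1,\dots,f_s$ of $B$ and $H_1,\dots,H_t$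 of the ideal of relations. Put $E_g^0(S)=S$ and recursively $E_g^i(S)=E_g(E_g^{i-1}(S))$ for $i>0$ (with some choice of generators at every step). *)

theory Defs
  imports Complex_Main "HOL-Library.Poly_Mapping"
begin

(* Polynomials in countably many indeterminates, indexed by nat: a monomial is an exponent
   vector (finitely supported nat to nat), a polynomial a finitely supported map from monomials
   to coefficients; the ring structure is the convolution product of Poly_Mapping.
   K[x_1,...,x_m] is the subring of polynomials involving only the indeterminates 0,...,m-1. *)
type_synonym 'k mpoly = "(nat \<Rightarrow>\<^sub>0 nat) \<Rightarrow>\<^sub>0 'k"

definition poly_ring :: "nat \<Rightarrow> 'k::field mpoly set" where
  "poly_ring m = {p. \<forall>\<mu> \<in> Poly_Mapping.keys p. Poly_Mapping.keys \<mu> \<subseteq> {..<m}}"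

definition const_poly :: "'k::field \<Rightarrow> 'k mpoly" where
  "const_poly c = Poly_Mapping.single 0 c"

(* H(f_1,...,f_s) for fs = [f_1,...,f_s]; only meant for H in poly_ring s, so that fs ! i is
   never evaluated out of bounds. *)
definition poly_subst :: "'k::field mpoly list \<Rightarrow> 'k mpoly \<Rightarrow> 'k mpoly" where
  "poly_subst fs H =
     (\<Sum>\<mu>\<in>Poly_Mapping.keys H. const_poly (Poly_Mapping.lookup H \<mu>) *
        (\<Prod>i\<in>Poly_Mapping.keys \<mu>. (fs ! i) ^ Poly_Mapping.lookup \<mu> i))"

(* K[f_1,...,f_s], the image of the K-algebra homomorphism K[x_1,...,x_s] -> P, x_i |-> f_i. *)
definition alg_gen :: "'k::field mpoly list \<Rightarrow> 'k mpoly set" where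
  "alg_gen fs = poly_subst fs ` poly_ring (length fs)"

definition finitely_generated_algebra :: "'k::field mpoly set \<Rightarrow> bool" where
  "finitely_generated_algebra A \<longleftrightarrow> (\<exists>fs. set fs \<subseteq> A \<and> A = alg_gen fs)"

(* The ideal of the ring R generated by X; only used for finite X. *)
definition ideal_gen :: "'k::field mpoly set \<Rightarrow> 'k mpoly set \<Rightarrow> 'k mpoly set" where
  "ideal_gen R X = {\<Sum>h\<in>X. a h * h | a. \<forall>h\<in>X. a h \<in> R}"

(* B : g^infinity inside P *)
definition saturation :: "'k::field mpoly set \<Rightarrow> 'k mpoly set \<Rightarrow> 'k mpoly \<Rightarrow> 'k mpoly set" where
  "saturation P B g = (\<Union>i::nat. {f \<in> P. g ^ i * f \<in> B})"

(* f : g^infinity for a single polynomial f in P. *)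
definition poly_saturation :: "'k::field mpoly set \<Rightarrow> 'k mpoly \<Rightarrow> 'k mpoly \<Rightarrow> 'k mpoly" where
  "poly_saturation P f g =
     (if f = 0 \<or> g \<in> range const_poly then f
      else THE q. q \<in> P \<and> f = g ^ (GREATEST i. \<exists>q\<in>P. f = g ^ i * q) * q)"

(* Rel_g(f_1,...,f_s): the kernel of K[x_1,...,x_s] -> P -> P/<g>. *)
definition relations :: "'k::field mpoly set \<Rightarrow> 'k mpoly \<Rightarrow> 'k mpoly list \<Rightarrow> 'k mpoly set" where
  "relations P g fs = {H \<in> poly_ring (length fs). poly_subst fs H \<in> ideal_gen P {g}}"

(* "C is an E_g(B)": C arises from B by the construction of E_g(B), for some choice of
   generators f_1,...,f_s of B and of generators H_1,...,H_t of Rel_g(f_1,...,f_s).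
   A relation rather than a function, since E_g(B) depends on these choices. *)
definition is_E :: "'k::field mpoly set \<Rightarrow> 'k mpoly \<Rightarrow> 'k mpoly set \<Rightarrow> 'k mpoly set \<Rightarrow> bool" where
  "is_E P g B C \<longleftrightarrow>
     (\<exists>fs Hs. set fs \<subseteq> P \<and> B = alg_gen fs \<and>
        set Hs \<subseteq> poly_ring (length fs) \<and>
        ideal_gen (poly_ring (length fs)) (set Hs) = relations P g fs \<and>
        C = alg_gen (fs @ map (\<lambda>H. poly_saturation P (poly_subst fs H) g) Hs))"

(* E 0, E 1, ... is a sequence E_g^i(S); the generators are chosen afresh at every step (they
   need not extend those of the previous step). *)
definition is_E_sequence ::
    "'k::field mpoly set \<Rightarrow> 'k mpoly \<Rightarrow> 'k mpoly set \<Rightarrow> (nat \<Rightarrow> 'k mpoly set) \<Rightarrow> bool" where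
  "is_E_sequence P g S E \<longleftrightarrow> E 0 = S \<and> (\<forall>i. is_E P g (E i) (E (Suc i)))"

end

theory Submission
  imports Defs
begin

text \<open>
  The key inclusions are \<open>{f \<in> P | g f \<in> B} \<subseteq> E\<^sub>g(B) \<subseteq> B : g\<^sup>\<infinity>\<close> for a subalgebra \<open>B\<close>
  with \<open>g \<in> B\<close>. For the first one (\<open>quotient_in_target\<close>), write \<open>g f = F(f\<^sub>1, \<dots>, f\<^sub>s)\<close>;
  then \<open>F\<close> is a relation modulo \<open>g\<close>, so \<open>F = \<Sum>\<^sub>j A\<^sub>j H\<^sub>j\<close>. For nonconstant \<open>g\<close>, every
  \<open>H\<^sub>j(f\<^sub>1, \<dots>, f\<^sub>s)\<close> is divisible by \<open>g\<close>, hence has the form \<open>g\<^sup>e h\<^sub>j\<close> with \<open>e \<ge> 1\<close>, and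
  cancelling \<open>g\<close> in \<open>g f = \<Sum>\<^sub>j A\<^sub>j(f\<^sub>1, \<dots>, f\<^sub>s) g\<^sup>e h\<^sub>j\<close> exhibits \<open>f\<close> as an element of
  \<open>E\<^sub>g(B)\<close>. A nonzero constant \<open>g\<close> is a unit in \<open>B\<close>. The second inclusion
  (\<open>target_subset_saturation\<close>) holds because \<open>B : g\<^sup>\<infinity>\<close> is a subalgebra that contains the
  generators of \<open>E\<^sub>g(B)\<close>.

  Iterating both inclusions, \<open>S : g\<^sup>\<infinity>\<close> is the union of the ascending chain \<open>E\<^sub>g\<^sup>i(S)\<close>
  (\<open>saturation_eq_Union_E_sequence\<close>). If it is finitely generated, its generators all lie in
  one member of the chain, which is then constant from there on. Conversely, if
  \<open>E\<^sub>g\<^sup>i(S) = E\<^sub>g\<^sup>i\<^sup>+\<^sup>1(S) =: B\<close>, then the first inclusion says that \<open>g f \<in> B\<close> implies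
  \<open>f \<in> B\<close>, so \<open>B = B : g\<^sup>\<infinity> = S : g\<^sup>\<infinity>\<close>; and \<open>B\<close> is finitely generated by construction.

  The highest power of \<open>g\<close> (if \<open>g\<close> is nonconstant) dividing a nonzero polynomial exists
  because leading monomials for the lexicographic order are additive under multiplication (\<open>power_divisors_bounded\<close>).
\<close>

section \<open>Subalgebras and substitution\<close>

text \<open>A subset of the polynomial ring is a \<open>K\<close>-subalgebra if it contains the constants and is
  closed under addition and multiplication; closure under negation follows by multiplying with
  the constant \<open>-1\<close>.\<close>

definition subalgebra :: "'k::field mpoly set \<Rightarrow> bool" where
  "subalgebra A \<longleftrightarrow> (\<forall>c. const_poly c \<in> A) \<and> (\<forall>p\<in>A. \<forall>q\<in>A. p + q \<in> A \<and> p * q \<in> A)"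

lemma subalgebra_const: "subalgebra A \<Longrightarrow> const_poly c \<in> A"
  and subalgebra_add: "subalgebra A \<Longrightarrow> p \<in> A \<Longrightarrow> q \<in> A \<Longrightarrow> p + q \<in> A"
  and subalgebra_mult: "subalgebra A \<Longrightarrow> p \<in> A \<Longrightarrow> q \<in> A \<Longrightarrow> p * q \<in> A"
  by (auto simp: subalgebra_def)

lemma const_poly_0 [simp]: "const_poly 0 = 0"
  and const_poly_1 [simp]: "const_poly 1 = 1"
  and const_poly_mult: "const_poly (c * d) = const_poly c * const_poly d"
  and const_poly_add: "const_poly (c + d) = const_poly c + const_poly d"
  by (simp_all add: const_poly_def mult_single single_add)

lemma subalgebra_0: "subalgebra A \<Longrightarrow> 0 \<in> A"
  and subalgebra_1: "subalgebra A \<Longrightarrow> 1 \<in> A"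
  using subalgebra_const[of A 0] subalgebra_const[of A 1] by simp_all

lemma subalgebra_sum: "subalgebra A \<Longrightarrow> (\<And>i. i \<in> I \<Longrightarrow> f i \<in> A) \<Longrightarrow> sum f I \<in> A"
  by (induction I rule: infinite_finite_induct) (auto intro: subalgebra_add subalgebra_0)

lemma subalgebra_prod: "subalgebra A \<Longrightarrow> (\<And>i. i \<in> I \<Longrightarrow> f i \<in> A) \<Longrightarrow> prod f I \<in> A"
  by (induction I rule: infinite_finite_induct) (auto intro: subalgebra_mult subalgebra_1)

lemma subalgebra_power: "subalgebra A \<Longrightarrow> p \<in> A \<Longrightarrow> p ^ i \<in> A"
  by (induction i) (auto intro: subalgebra_mult subalgebra_1)

lemma subalgebra_poly_ring: "subalgebra (poly_ring m :: 'k::field mpoly set)"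
  unfolding subalgebra_def
proof (intro conjI allI ballI)
  show "const_poly c \<in> poly_ring m" for c :: 'k
    by (auto simp: const_poly_def poly_ring_def)
next
  fix p q :: "'k mpoly"
  assume p: "p \<in> poly_ring m" and q: "q \<in> poly_ring m"
  show "p + q \<in> poly_ring m"
    using p q Poly_Mapping.keys_add[of p q] by (auto simp: poly_ring_def subset_iff)
  show "p * q \<in> poly_ring m"
    unfolding poly_ring_def
  proof (intro CollectI ballI)
    fix \<mu> assume "\<mu> \<in> Poly_Mapping.keys (p * q)"
    then obtain a b where "a \<in> Poly_Mapping.keys p" "b \<in> Poly_Mapping.keys q" and \<mu>: "\<mu> = a + b"
      using keys_mult[of p q] by auto
    with p q have "Poly_Mapping.keys a \<subseteq> {..<m}" "Poly_Mapping.keys b \<subseteq> {..<m}"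
      by (auto simp: poly_ring_def)
    then show "Poly_Mapping.keys \<mu> \<subseteq> {..<m}"
      unfolding \<mu> using Poly_Mapping.keys_add[of a b] by blast
  qed
qed

text \<open>The value of the monomial with exponent vector \<open>\<mu>\<close> at \<open>fs\<close>. As in \<^const>\<open>poly_subst\<close>, the
  elements \<open>fs ! i\<close> with \<open>i\<close> beyond the length of \<open>fs\<close> are unspecified; substitution is a ring
  homomorphism on all polynomials regardless of their values.\<close>

definition monom_subst :: "'k::field mpoly list \<Rightarrow> (nat \<Rightarrow>\<^sub>0 nat) \<Rightarrow> 'k mpoly" where
  "monom_subst fs \<mu> = (\<Prod>i\<in>Poly_Mapping.keys \<mu>. (fs ! i) ^ Poly_Mapping.lookup \<mu> i)"

lemma monom_subst_superset:
  assumes "finite I" "Poly_Mapping.keys \<mu> \<subseteq> I"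
  shows "monom_subst fs \<mu> = (\<Prod>i\<in>I. (fs ! i) ^ Poly_Mapping.lookup \<mu> i)"
  unfolding monom_subst_def
  by (rule prod.mono_neutral_left) (use assms in \<open>auto simp: in_keys_iff\<close>)

lemma monom_subst_add: "monom_subst fs (\<mu> + \<nu>) = monom_subst fs \<mu> * monom_subst fs \<nu>"
proof -
  let ?I = "Poly_Mapping.keys \<mu> \<union> Poly_Mapping.keys \<nu>"
  show ?thesis
    using Poly_Mapping.keys_add[of \<mu> \<nu>]
    by (simp add: monom_subst_superset[of ?I] lookup_add power_add prod.distrib)
qed

lemma poly_subst_superset:
  assumes "finite M" "Poly_Mapping.keys H \<subseteq> M"
  shows "poly_subst fs H = (\<Sum>\<mu>\<in>M. const_poly (Poly_Mapping.lookup H \<mu>) * monom_subst fs \<mu>)"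
  unfolding poly_subst_def monom_subst_def[symmetric]
  by (rule sum.mono_neutral_left) (use assms in \<open>auto simp: in_keys_iff\<close>)

lemma poly_subst_add: "poly_subst fs (H + G) = poly_subst fs H + poly_subst fs G"
proof -
  let ?M = "Poly_Mapping.keys H \<union> Poly_Mapping.keys G"
  show ?thesis
    using Poly_Mapping.keys_add[of H G]
    by (simp add: poly_subst_superset[of ?M] lookup_add const_poly_add algebra_simps sum.distrib)
qed

lemma poly_subst_0 [simp]: "poly_subst fs 0 = 0"
  by (simp add: poly_subst_def)

lemma poly_subst_sum: "poly_subst fs (sum H I) = (\<Sum>i\<in>I. poly_subst fs (H i))"
  by (induction I rule: infinite_finite_induct) (auto simp: poly_subst_add)

lemma poly_subst_single:
  "poly_subst fs (Poly_Mapping.single \<mu> c) = const_poly c * monom_subst fs \<mu>"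
  by (simp add: poly_subst_superset[of "{\<mu>}"])

lemma poly_eq_sum_single:
  "H = (\<Sum>\<mu>\<in>Poly_Mapping.keys H. Poly_Mapping.single \<mu> (Poly_Mapping.lookup H \<mu>))"
  by (rule poly_mapping_eqI)
    (auto simp: lookup_sum lookup_single when_def in_keys_iff)

lemma mult_eq_sum_single:
  fixes H G :: "'k::field mpoly"
  shows "H * G = (\<Sum>\<mu>\<in>Poly_Mapping.keys H. \<Sum>\<nu>\<in>Poly_Mapping.keys G.
    Poly_Mapping.single (\<mu> + \<nu>) (Poly_Mapping.lookup H \<mu> * Poly_Mapping.lookup G \<nu>))"
  unfolding mult_single[symmetric] sum_product[symmetric] by (simp flip: poly_eq_sum_single)

lemma poly_subst_mult: "poly_subst fs (H * G) = poly_subst fs H * poly_subst fs G"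
proof -
  have "poly_subst fs (H * G) = (\<Sum>\<mu>\<in>Poly_Mapping.keys H. \<Sum>\<nu>\<in>Poly_Mapping.keys G.
      (const_poly (Poly_Mapping.lookup H \<mu>) * monom_subst fs \<mu>) *
      (const_poly (Poly_Mapping.lookup G \<nu>) * monom_subst fs \<nu>))"
    by (subst mult_eq_sum_single)
      (simp add: poly_subst_sum poly_subst_single const_poly_mult monom_subst_add mult_ac)
  also have "\<dots> = poly_subst fs H * poly_subst fs G"
    by (simp add: poly_subst_superset[of "Poly_Mapping.keys H" H]
        poly_subst_superset[of "Poly_Mapping.keys G" G] sum_product)
  finally show ?thesis .
qed

lemma poly_subst_const: "poly_subst fs (const_poly c) = const_poly c"
  by (simp add: const_poly_def[of c] poly_subst_single)
    (simp add: const_poly_def monom_subst_def)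

section \<open>Finitely generated subalgebras\<close>

lemma subalgebra_alg_gen: "subalgebra (alg_gen fs)"
  unfolding subalgebra_def
proof (intro conjI allI ballI)
  show "const_poly c \<in> alg_gen fs" for c
    unfolding alg_gen_def
    by (rule image_eqI[of _ _ "const_poly c"])
      (auto simp: poly_subst_const intro: subalgebra_const subalgebra_poly_ring)
next
  fix p q assume "p \<in> alg_gen fs" "q \<in> alg_gen fs"
  then obtain H G where "H \<in> poly_ring (length fs)" "G \<in> poly_ring (length fs)"
    "p = poly_subst fs H" "q = poly_subst fs G"
    by (auto simp: alg_gen_def)
  then show "p + q \<in> alg_gen fs" "p * q \<in> alg_gen fs"
    by (auto simp: alg_gen_def simp flip: poly_subst_add poly_subst_mult
        intro!: imageI subalgebra_add subalgebra_mult subalgebra_poly_ring)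
qed

lemma set_subset_alg_gen: "set fs \<subseteq> alg_gen fs"
proof
  fix f assume "f \<in> set fs"
  then obtain i where i: "i < length fs" "f = fs ! i"
    by (auto simp: in_set_conv_nth)
  let ?X = "Poly_Mapping.single (Poly_Mapping.single i 1) 1"
  have "f = poly_subst fs ?X"
    by (simp add: poly_subst_single monom_subst_def i)
  moreover have "?X \<in> poly_ring (length fs)"
    using i by (simp add: poly_ring_def)
  ultimately show "f \<in> alg_gen fs"
    unfolding alg_gen_def by blast
qed

lemma alg_gen_minimal:
  assumes "subalgebra A" "set fs \<subseteq> A"
  shows "alg_gen fs \<subseteq> A"
proof -
  have "poly_subst fs H \<in> A" if "H \<in> poly_ring (length fs)" for H
    unfolding poly_subst_def
  proof (intro subalgebra_sum subalgebra_mult subalgebra_const subalgebra_prod subalgebra_power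
      assms(1))
    fix \<mu> i assume "\<mu> \<in> Poly_Mapping.keys H" "i \<in> Poly_Mapping.keys \<mu>"
    with that have "i < length fs"
      by (auto simp: poly_ring_def)
    then show "fs ! i \<in> A"
      using assms(2) by auto
  qed
  then show ?thesis
    by (auto simp: alg_gen_def)
qed

lemma finitely_generated_alg_gen: "finitely_generated_algebra (alg_gen fs)"
  unfolding finitely_generated_algebra_def using set_subset_alg_gen by blast

section \<open>Powers of a polynomial dividing another\<close>

text \<open>The greatest monomial of \<open>p\<close>, meaningful for \<open>p \<noteq> 0\<close>. The monomials are ordered
  by the linear order of the type, which is a lexicographic one.\<close>

definition lead_monom :: "'k::field mpoly \<Rightarrow> (nat \<Rightarrow>\<^sub>0 nat)" where
  "lead_monom p = Max (Poly_Mapping.keys p)"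

lemma lead_monom_in_keys: "p \<noteq> 0 \<Longrightarrow> lead_monom p \<in> Poly_Mapping.keys p"
  unfolding lead_monom_def by (rule Max_in) simp_all

lemma le_lead_monom: "\<mu> \<in> Poly_Mapping.keys p \<Longrightarrow> \<mu> \<le> lead_monom p"
  unfolding lead_monom_def by (rule Max_ge) simp_all

lemma zero_le_monom: "(0 :: nat \<Rightarrow>\<^sub>0 nat) \<le> \<mu>"
proof (rule ccontr)
  assume "\<not> 0 \<le> \<mu>"
  then have "\<mu> < 0" by simp
  then show False
    by transfer (auto simp: less_fun_def)
qed

lemma lead_monom_mult:
  fixes p q :: "'k::field mpoly"
  assumes "p \<noteq> 0" "q \<noteq> 0"
  shows "lead_monom (p * q) = lead_monom p + lead_monom q"
proof -
  let ?a = "lead_monom p" and ?b = "lead_monom q"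
  have le: "\<mu> \<le> ?a + ?b" if "\<mu> \<in> Poly_Mapping.keys (p * q)" for \<mu>
    using that keys_mult[of p q] by (auto intro: add_mono le_lead_monom)
  have nonzero: "p * q \<noteq> 0"
    using assms by simp
  \<comment> \<open>Only the pair of leading monomials contributes to the coefficient of their product.\<close>
  have unique: "\<mu> + \<nu> = ?a + ?b \<longleftrightarrow> \<mu> = ?a \<and> \<nu> = ?b"
    if "\<mu> \<in> Poly_Mapping.keys p" "\<nu> \<in> Poly_Mapping.keys q" for \<mu> \<nu>
  proof
    note bounds = le_lead_monom[OF that(1)] le_lead_monom[OF that(2)]
    assume eq: "\<mu> + \<nu> = ?a + ?b"
    have "\<not> \<mu> < ?a"
      using add_less_le_mono[of \<mu> ?a \<nu> ?b] bounds(2) eq by auto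
    with bounds(1) have "\<mu> = ?a"
      by simp
    with eq show "\<mu> = ?a \<and> \<nu> = ?b"
      by simp
  qed simp
  have "Poly_Mapping.lookup (p * q) (?a + ?b) =
      (\<Sum>\<mu>\<in>Poly_Mapping.keys p. \<Sum>\<nu>\<in>Poly_Mapping.keys q.
        if \<mu> = ?a then if \<nu> = ?b then Poly_Mapping.lookup p ?a * Poly_Mapping.lookup q ?b
        else 0 else 0)"
    unfolding mult_eq_sum_single lookup_sum
    by (intro sum.cong refl) (simp add: lookup_single when_def unique)
  also have "\<dots> = (\<Sum>\<mu>\<in>Poly_Mapping.keys p.
      if \<mu> = ?a then Poly_Mapping.lookup p ?a * Poly_Mapping.lookup q ?b else 0)"
    using lead_monom_in_keys[OF assms(2)] by (intro sum.cong refl) simp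
  also have "\<dots> = Poly_Mapping.lookup p ?a * Poly_Mapping.lookup q ?b"
    using lead_monom_in_keys[OF assms(1)] by simp
  also have "\<dots> \<noteq> 0"
    using assms[THEN lead_monom_in_keys] by (simp add: in_keys_iff)
  finally have "Poly_Mapping.lookup (p * q) (?a + ?b) \<noteq> 0" .
  then have "?a + ?b \<in> Poly_Mapping.keys (p * q)"
    by (simp add: in_keys_iff)
  then show ?thesis
    by (intro antisym le le_lead_monom lead_monom_in_keys nonzero)
qed

lemma lead_monom_nonconstant:
  assumes "g \<notin> range const_poly"
  shows "lead_monom g \<noteq> 0"
proof
  assume lm: "lead_monom g = 0"
  have "\<mu> = 0" if "\<mu> \<in> Poly_Mapping.keys g" for \<mu>
    using le_lead_monom[OF that] zero_le_monom[of \<mu>] lm by simp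
  then have "g = const_poly (Poly_Mapping.lookup g 0)"
    unfolding const_poly_def
    by (intro poly_mapping_eqI) (metis in_keys_iff lookup_single_eq lookup_single_not_eq)
  then show False
    using assms by blast
qed

text \<open>The exponent of a variable occurring in the leading monomial of \<open>g\<close> is at least \<open>i\<close> in the
  leading monomial of \<open>g\<^sup>i q\<close>, which bounds \<open>i\<close>.\<close>

lemma power_divisors_bounded:
  fixes f g :: "'k::field mpoly"
  assumes "f \<noteq> 0" "g \<notin> range const_poly"
  shows "\<exists>N. \<forall>i q. f = g ^ i * q \<longrightarrow> i \<le> N"
proof -
  obtain j where j: "Poly_Mapping.lookup (lead_monom g) j > 0"
    using lead_monom_nonconstant[OF assms(2)]
    by (metis lookup_zero neq0_conv poly_mapping_eqI)
  have "g \<noteq> 0"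
    using assms(2) by (metis const_poly_0 rangeI)
  have "i \<le> Poly_Mapping.lookup (lead_monom (g ^ i * q)) j" if "q \<noteq> 0" for i q
  proof (induction i)
    case (Suc i)
    have "lead_monom (g ^ Suc i * q) = lead_monom g + lead_monom (g ^ i * q)"
      using \<open>g \<noteq> 0\<close> that by (simp add: mult.assoc lead_monom_mult)
    with Suc j show ?case
      by (simp add: lookup_add)
  qed simp
  then show ?thesis
    using assms(1) by (metis mult_zero_right)
qed

text \<open>For \<open>f \<noteq> 0\<close> and nonconstant \<open>g\<close>, the greatest exponent and the cofactor in the definition of
  \<open>f : g\<^sup>\<infinity>\<close> exist, and the cofactor is unique since polynomials form an integral domain.\<close>

lemma poly_saturation_factor:
  fixes f g :: "'k::field mpoly"
  assumes "f \<in> P" "f \<noteq> 0" "g \<notin> range const_poly"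
  obtains e where "poly_saturation P f g \<in> P" "f = g ^ e * poly_saturation P f g"
    "\<And>i q. q \<in> P \<Longrightarrow> f = g ^ i * q \<Longrightarrow> i \<le> e"
proof -
  let ?D = "\<lambda>i. \<exists>q\<in>P. f = g ^ i * q"
  define e where "e = (GREATEST i. ?D i)"
  obtain N where N: "\<And>i. ?D i \<Longrightarrow> i \<le> N"
    using power_divisors_bounded[OF assms(2,3)] by blast
  have "?D 0"
    using assms(1) by auto
  then have "?D e"
    unfolding e_def using N by (rule GreatestI_nat)
  then obtain q where q: "q \<in> P" "f = g ^ e * q"
    by blast
  have "g \<noteq> 0"
    using assms(3) by (metis const_poly_0 rangeI)
  then have "poly_saturation P f g = q"
    unfolding poly_saturation_def e_def[symmetric]
    using assms q by (auto intro!: the_equality)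
  moreover have "i \<le> e" if "q \<in> P" "f = g ^ i * q" for i q
    unfolding e_def by (rule Greatest_le_nat[of ?D i N]) (use that N in auto)
  ultimately show thesis
    using q that by blast
qed

section \<open>Saturation and one step of the construction\<close>

lemma saturation_iff: "f \<in> saturation P B g \<longleftrightarrow> f \<in> P \<and> (\<exists>i. g ^ i * f \<in> B)"
  by (auto simp: saturation_def)

lemma subset_saturation: "B \<subseteq> P \<Longrightarrow> B \<subseteq> saturation P B g"
proof
  fix f assume "B \<subseteq> P" "f \<in> B"
  then have "f \<in> P" "g ^ 0 * f \<in> B"
    by auto
  then show "f \<in> saturation P B g"
    unfolding saturation_iff by blast
qed

lemma saturation_mono: "B \<subseteq> C \<Longrightarrow> saturation P B g \<subseteq> saturation P C g"
  by (auto simp: saturation_def)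

lemma saturation_saturation: "saturation P (saturation P B g) g \<subseteq> saturation P B g"
  by (auto simp: saturation_iff simp flip: mult.assoc power_add)

lemma subalgebra_saturation:
  assumes "subalgebra P" "subalgebra B" "g \<in> B"
  shows "subalgebra (saturation P B g)"
  unfolding subalgebra_def
proof (intro conjI allI ballI)
  show "const_poly c \<in> saturation P B g" for c
  proof -
    have "g ^ 0 * const_poly c \<in> B"
      using assms by (simp add: subalgebra_const)
    then show ?thesis
      using assms(1) subalgebra_const unfolding saturation_iff by blast
  qed
next
  fix p q assume "p \<in> saturation P B g" "q \<in> saturation P B g"
  then obtain i j where p: "p \<in> P" "g ^ i * p \<in> B" and q: "q \<in> P" "g ^ j * q \<in> B"
    by (auto simp: saturation_iff)
  have "g ^ (i + j) * (p + q) = g ^ j * (g ^ i * p) + g ^ i * (g ^ j * q)"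
    by (simp add: power_add algebra_simps)
  also have "\<dots> \<in> B"
    by (intro subalgebra_add subalgebra_mult subalgebra_power assms p q)
  finally show "p + q \<in> saturation P B g"
    using p q assms(1) by (auto simp: saturation_iff intro: subalgebra_add)
  have "g ^ (i + j) * (p * q) = (g ^ i * p) * (g ^ j * q)"
    by (simp add: power_add algebra_simps)
  also have "\<dots> \<in> B"
    by (intro subalgebra_mult assms p q)
  finally show "p * q \<in> saturation P B g"
    using p q assms(1) by (auto simp: saturation_iff intro: subalgebra_mult)
qed

lemma ideal_gen_singleton: "ideal_gen P {g} = {a * g | a. a \<in> P}"
  by (auto simp: ideal_gen_def intro: exI[of _ "\<lambda>_. _"])

lemma ideal_gen_incl:
  assumes "finite X" "h \<in> X" "subalgebra R"
  shows "h \<in> ideal_gen R X"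
proof -
  have "(\<Sum>h'\<in>X. (if h' = h then 1 else 0) * h') = (\<Sum>h'\<in>X. if h' = h then h' else 0)"
    by (intro sum.cong) auto
  also have "\<dots> = h"
    using assms by simp
  finally show ?thesis
    unfolding ideal_gen_def using assms(3)
    by (intro CollectI exI[of _ "\<lambda>h'. if h' = h then 1 else 0"])
      (auto intro: subalgebra_0 subalgebra_1)
qed

text \<open>The algebra \<open>C\<close> is an \<open>E\<^sub>g(B)\<close>, where \<open>g \<in> B\<close> is nonzero.\<close>

locale E_step =
  fixes P B C :: "'k::field mpoly set" and g :: "'k mpoly"
  assumes P: "subalgebra P" and g: "g \<in> B" "g \<noteq> 0" and step: "is_E P g B C"
begin

lemma obtain_generators:
  obtains fs Hs where "set fs \<subseteq> P" "B = alg_gen fs" "set Hs \<subseteq> poly_ring (length fs)"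
    "ideal_gen (poly_ring (length fs)) (set Hs) = relations P g fs"
    "C = alg_gen (fs @ map (\<lambda>H. poly_saturation P (poly_subst fs H) g) Hs)"
  using step unfolding is_E_def by blast

lemma subalgebra_source: "subalgebra B"
  by (rule obtain_generators) (simp add: subalgebra_alg_gen)

lemma subalgebra_target: "subalgebra C"
  by (rule obtain_generators) (simp add: subalgebra_alg_gen)

lemma source_subset: "B \<subseteq> P"
  by (rule obtain_generators) (simp add: alg_gen_minimal P)

lemma source_subset_target: "B \<subseteq> C"
proof (rule obtain_generators)
  fix fs Hs
  assume "B = alg_gen fs" "C = alg_gen (fs @ map (\<lambda>H. poly_saturation P (poly_subst fs H) g) Hs)"
  then show ?thesis
    using set_subset_alg_gen[of "fs @ map (\<lambda>H. poly_saturation P (poly_subst fs H) g) Hs"]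
    by (simp add: alg_gen_minimal subalgebra_alg_gen)
qed

lemma target_subset_saturation: "C \<subseteq> saturation P B g"
proof (rule obtain_generators)
  fix fs Hs
  let ?h = "\<lambda>H. poly_saturation P (poly_subst fs H) g"
  assume B: "B = alg_gen fs" and C: "C = alg_gen (fs @ map ?h Hs)"
    and Hs: "set Hs \<subseteq> poly_ring (length fs)"
  have "?h H \<in> saturation P B g" if "H \<in> set Hs" for H
  proof -
    have f: "poly_subst fs H \<in> B"
      using that Hs by (auto simp: B alg_gen_def)
    show ?thesis
    proof (cases "poly_subst fs H = 0 \<or> g \<in> range const_poly")
      case True
      then have "?h H = poly_subst fs H"
        by (simp add: poly_saturation_def)
      then show ?thesis
        using f subset_saturation[OF source_subset] by auto
    next
      case False
      then show ?thesis
        using poly_saturation_factor[of "poly_subst fs H" P g] f source_subset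
        unfolding saturation_iff by (metis subsetD)
    qed
  qed
  moreover have "set fs \<subseteq> saturation P B g"
    using set_subset_alg_gen[of fs] subset_saturation[OF source_subset] B by blast
  ultimately show ?thesis
    unfolding C
    by (intro alg_gen_minimal subalgebra_saturation P subalgebra_source g) auto
qed

text \<open>One step of the construction divides by \<open>g\<close> once: if \<open>g f \<in> B\<close>, then \<open>g f\<close> is the value
  of a relation, and for nonconstant \<open>g\<close> the values of the generating relations are divisible by
  \<open>g\<close> within \<open>C\<close>.\<close>

lemma quotient_in_target:
  assumes f: "f \<in> P" and gf: "g * f \<in> B"
  shows "f \<in> C"
proof (cases "g \<in> range const_poly")
  case True
  then obtain c where c: "g = const_poly c"
    by blast
  with g have "c \<noteq> 0"
    by auto
  then have "f = const_poly (inverse c) * (g * f)"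
    by (simp add: c flip: mult.assoc const_poly_mult)
  also have "\<dots> \<in> B"
    by (intro subalgebra_mult subalgebra_const subalgebra_source gf)
  finally show ?thesis
    using source_subset_target by blast
next
  case nonconst: False
  show ?thesis
  proof (rule obtain_generators)
    fix fs Hs :: "'k mpoly list"
    let ?R = "poly_ring (length fs)"
    let ?h = "\<lambda>H. poly_saturation P (poly_subst fs H) g"
    assume B: "B = alg_gen fs" and C: "C = alg_gen (fs @ map ?h Hs)"
      and Hs: "set Hs \<subseteq> ?R" and rel: "ideal_gen ?R (set Hs) = relations P g fs"
    obtain F where F: "F \<in> ?R" "g * f = poly_subst fs F"
      using gf by (auto simp: B alg_gen_def)
    have "poly_subst fs F = f * g"
      using F(2) by (simp add: mult.commute)
    then have "F \<in> relations P g fs"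
      using F(1) f unfolding relations_def ideal_gen_singleton by blast
    then obtain A where A: "\<And>H. H \<in> set Hs \<Longrightarrow> A H \<in> ?R" "F = (\<Sum>H\<in>set Hs. A H * H)"
      unfolding rel[symmetric] ideal_gen_def by blast
    have "\<exists>e. poly_subst fs H = g * (g ^ e * ?h H)" if H: "H \<in> set Hs" for H
    proof (cases "poly_subst fs H = 0")
      case True
      then show ?thesis
        by (simp add: poly_saturation_def)
    next
      case False
      have "H \<in> relations P g fs"
        unfolding rel[symmetric] using H by (simp add: ideal_gen_incl subalgebra_poly_ring)
      then obtain a where a: "a \<in> P" "poly_subst fs H = g ^ 1 * a"
        by (auto simp: relations_def ideal_gen_singleton mult.commute)
      have "poly_subst fs H \<in> P"
        using H Hs source_subset by (auto simp: B alg_gen_def)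
      then obtain e where e: "poly_subst fs H = g ^ e * ?h H" "1 \<le> e"
        using poly_saturation_factor[OF _ False nonconst] a by metis
      then show ?thesis
        by (intro exI[of _ "e - 1"]) (metis mult.assoc power_eq_if not_one_le_zero)
    qed
    then obtain e where e: "\<And>H. H \<in> set Hs \<Longrightarrow> poly_subst fs H = g * (g ^ e H * ?h H)"
      using bchoice[of "set Hs" "\<lambda>H e. poly_subst fs H = g * (g ^ e * ?h H)"] by blast
    have "g * f = (\<Sum>H\<in>set Hs. poly_subst fs (A H) * poly_subst fs H)"
      by (simp add: F A poly_subst_sum poly_subst_mult)
    also have "\<dots> = g * (\<Sum>H\<in>set Hs. poly_subst fs (A H) * (g ^ e H * ?h H))"
      unfolding sum_distrib_left
    proof (intro sum.cong refl)
      fix H assume "H \<in> set Hs"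
      \<comment> \<open>The equation is used exactly once, since its left-hand side recurs inside \<open>?h H\<close>.\<close>
      from arg_cong[OF e[OF this], of "(*) (poly_subst fs (A H))"]
      show "poly_subst fs (A H) * poly_subst fs H = g * (poly_subst fs (A H) * (g ^ e H * ?h H))"
        by (simp only: mult.left_commute[of g])
    qed
    finally have "f = (\<Sum>H\<in>set Hs. poly_subst fs (A H) * (g ^ e H * ?h H))"
      using g by simp
    also have "\<dots> \<in> C"
    proof (intro subalgebra_sum subalgebra_mult subalgebra_power subalgebra_target)
      fix H assume H: "H \<in> set Hs"
      show "poly_subst fs (A H) \<in> C"
        using A(1)[OF H] source_subset_target by (auto simp: B alg_gen_def)
      show "g \<in> C"
        using g source_subset_target by blast
      show "?h H \<in> C"
        using set_subset_alg_gen[of "fs @ map ?h Hs"] H by (auto simp: C)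
    qed
    finally show ?thesis .
  qed
qed

lemma power_mult_closed: "f \<in> P \<Longrightarrow> g ^ k * f \<in> P"
  using g source_subset by (intro subalgebra_mult subalgebra_power P) auto

text \<open>If one step adds nothing, then \<open>B\<close> is closed under division by \<open>g\<close>, whatever generators a
  further step would choose.\<close>

lemma saturation_subset_source:
  assumes "C = B"
  shows "saturation P B g \<subseteq> B"
proof -
  have "f \<in> B" if "f \<in> P" "g ^ k * f \<in> B" for f k
    using that(2)
  proof (induction k)
    case (Suc k)
    then have "g ^ k * f \<in> C"
      using that(1) by (intro quotient_in_target power_mult_closed) (simp_all add: mult.assoc)
    with assms Suc.IH show ?case
      by simp
  qed simp
  then show ?thesis
    by (auto simp: saturation_iff)
qed

end

section \<open>The sequence of algebras\<close>

text \<open>The algebras \<open>E i\<close> are an \<open>E\<^sub>g\<^sup>i(S)\<close> sequence.\<close>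

locale E_chain =
  fixes P S :: "'k::field mpoly set" and g :: "'k mpoly" and E :: "nat \<Rightarrow> 'k mpoly set"
  assumes P: "subalgebra P" and g: "g \<in> S" "g \<noteq> 0" and chain: "is_E_sequence P g S E"
begin

lemma E_0: "E 0 = S"
  using chain by (simp add: is_E_sequence_def)

lemma is_E_E: "is_E P g (E i) (E (Suc i))"
  using chain by (simp add: is_E_sequence_def)

lemma g_in_E: "g \<in> E i"
proof (induction i)
  case 0
  show ?case using g by (simp add: E_0)
next
  case (Suc i)
  then interpret E_step P "E i" "E (Suc i)" g
    by unfold_locales (use P g is_E_E in auto)
  show ?case
    using Suc source_subset_target by blast
qed

sublocale step: E_step P "E i" "E (Suc i)" g for i
  by unfold_locales (use P g g_in_E is_E_E in auto)

lemma E_mono: "i \<le> j \<Longrightarrow> E i \<subseteq> E j"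
  by (rule lift_Suc_mono_le[of E]) (rule step.source_subset_target)

lemma E_subset_saturation: "E i \<subseteq> saturation P S g"
proof (induction i)
  case 0
  show ?case
    using subset_saturation[OF step.source_subset[of 0]] by (simp add: E_0)
next
  case (Suc i)
  have "E (Suc i) \<subseteq> saturation P (E i) g"
    by (rule step.target_subset_saturation)
  also have "\<dots> \<subseteq> saturation P (saturation P S g) g"
    by (rule saturation_mono) (rule Suc)
  also have "\<dots> \<subseteq> saturation P S g"
    by (rule saturation_saturation)
  finally show ?case .
qed

lemma power_quotient_in_E:
  assumes "f \<in> P" "g ^ k * f \<in> E i"
  shows "f \<in> E (i + k)"
  using assms
proof (induction k arbitrary: i)
  case (Suc k)
  then have "g ^ k * f \<in> E (Suc i)"
    by (intro step.quotient_in_target step.power_mult_closed) (simp_all add: mult.assoc)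
  with Suc.IH[of "Suc i"] Suc.prems show ?case
    by simp
qed simp

lemma saturation_eq_Union_E_sequence: "saturation P S g = (\<Union>i. E i)"
proof
  show "saturation P S g \<subseteq> (\<Union>i. E i)"
  proof
    fix f assume "f \<in> saturation P S g"
    then obtain k where "f \<in> P" "g ^ k * f \<in> E 0"
      by (auto simp: saturation_iff E_0)
    then have "f \<in> E (0 + k)"
      by (rule power_quotient_in_E)
    then show "f \<in> (\<Union>i. E i)"
      by blast
  qed
  show "(\<Union>i. E i) \<subseteq> saturation P S g"
    using E_subset_saturation by blast
qed

lemma stationary_imp_saturation:
  assumes "E i = E (Suc i)"
  shows "saturation P S g = E i"
proof
  show "E i \<subseteq> saturation P S g"
    by (rule E_subset_saturation)
  have "saturation P S g \<subseteq> saturation P (E i) g"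
    using E_mono[of 0 i] by (simp add: E_0 saturation_mono)
  also have "\<dots> \<subseteq> E i"
    by (rule step.saturation_subset_source) (simp add: assms)
  finally show "saturation P S g \<subseteq> E i" .
qed

lemma finitely_generated_imp_stationary:
  assumes "finitely_generated_algebra (saturation P S g)"
  shows "\<exists>i. E i = E (Suc i)"
proof -
  obtain fs where fs: "set fs \<subseteq> saturation P S g" "saturation P S g = alg_gen fs"
    using assms by (auto simp: finitely_generated_algebra_def)
  have "\<exists>i. set fs \<subseteq> E i"
  proof -
    have "\<forall>f\<in>set fs. \<exists>i. f \<in> E i"
      using fs(1) saturation_eq_Union_E_sequence by blast
    then obtain k where k: "\<And>f. f \<in> set fs \<Longrightarrow> f \<in> E (k f)"
      by metis
    have "f \<in> E (Max (k ` set fs))" if "f \<in> set fs" for f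
      using k[OF that] E_mono[of "k f" "Max (k ` set fs)"] that by auto
    then show ?thesis
      by blast
  qed
  then obtain i where "set fs \<subseteq> E i" ..
  then have "saturation P S g \<subseteq> E i"
    unfolding fs(2) by (rule alg_gen_minimal[OF step.subalgebra_source])
  then have "E i = E (Suc i)"
    using E_subset_saturation[of "Suc i"] step.source_subset_target[of i] by blast
  then show ?thesis ..
qed

lemma finitely_generated_E: "finitely_generated_algebra (E i)"
  by (rule step.obtain_generators[of i]) (simp add: finitely_generated_alg_gen)

end

theorem corollary3p11:
  fixes n :: nat
    and P S :: "'k::field mpoly set"
    and g :: "'k mpoly"
    and gs :: "'k mpoly list"
    and E :: "nat \<Rightarrow> 'k mpoly set"
  assumes "P = poly_ring (Suc n)"
    and "set gs \<subseteq> P"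
    and "S = alg_gen gs"
    and "g \<in> S" and "g \<noteq> 0"
    and "is_E_sequence P g S E"
  shows "(finitely_generated_algebra (saturation P S g) \<longleftrightarrow> (\<exists>i. E i = E (Suc i)))
    \<and> (\<forall>i. E i = E (Suc i) \<longrightarrow> saturation P S g = E i)"
proof -
  interpret E_chain P S g E
    by unfold_locales (use assms subalgebra_poly_ring in auto)
  have "finitely_generated_algebra (saturation P S g)" if "E i = E (Suc i)" for i
    unfolding stationary_imp_saturation[OF that] by (rule finitely_generated_E)
  then show ?thesis
    using stationary_imp_saturation finitely_generated_imp_stationary by blast
qed

end
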